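(* On $S^1$ with structure group $O(2)$ and fixed readout $\varphi$, let $s$ be the section given by a fibre angle $\phi$ and let $\sigma=\varphi\circ s$. Then the parity of the number of zeros of $\sigma$ equals $w_1(L_s)\in H^1(S^1;\mathbb{Z}_2)$, the first Stiefel--Whitney class of the real line subbundle $L_s=\mathrm{span}\{s\}$: (a) the number of zeros is even (including zero) if and only if $w_1(L_s)=0$ (orientable line field); (b) the number of zeros is odd if and only if $w_1(L_s)\neq0$ (Möbius line field). Both cases admit flat connections, and in both the ambient rank-$2$ bundle $E$ is trivial. The Möbius line field achieves the minimum: one zero of $\sigma$, that is, one decision boundary point.
   Context: $S^1=\mathbb{R}/2\pi\mathbb{Z}$ has coordinate $\alpha\in[0,2\pi)$, and $E\to S^1$ is a rank-$2$ real vector bundle with fibre $\mathbb{R}^2$ and structure group $O(2)$. The section is $s(\alpha)=r(\cos\phi(\alpha),\sin\phi(\alpha))^\top$ with constant $r>0$ and continuous fibre angle $\phi$ whose total rotation around the circle is $\Delta\phi=\phi(2\pi)-\phi(0)\in\pi\mathbb{Z}$. If $\Delta\phi\in\pi+2\pi\mathbb{Z}$, then $s$ is double-valued as a map to $\mathbb{R}^2$ (it returns to $-s$ after one traversal), but the line $[s(\alpha)]\in\mathbb{RP}^1$ is single-valued, so $L_s=\mathrm{span}\{s\}\subset E$ is a real line bundle over $S^1$; $w_1(L_s)\in H^1(S^1;\mathbb{Z}_2)\cong\mathbb{Z}_2$ is the degree mod $2$ of the line field $\alpha\mapsto[s(\alpha)]$, so $w_1(L_s)=0$ iff $\Delta\phi\in2\pi\mathbb{Z}$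 and $w_1(L_s)\neq0$ iff $\Delta\phi\in\pi+2\pi\mathbb{Z}$. The readout is the fibrewise linear functional $\varphi=(1,0)$ (a different symbol from the angle $\phi$), so $\sigma=r\cos\phi$; its zeros are counted on $[0,2\pi)$ and are the decision boundary points. Connections are of the form $d+\theta J$ with $\theta$ a $1$-form on $S^1$ and $J=\begin{pmatrix}0&-1\\1&0\end{pmatrix}$; the section is parallel when $\theta=-d\phi$, and the connection is flat when its curvature $d\theta\cdot J$ vanishes. The simplest Möbius case is $\phi(\alpha)=\alpha/2$, $\theta=-\tfrac12d\alpha$, $\sigma=r\cos(\alpha/2)$, with exactly one zero, at $\alpha=\pi$.
   Formalization: The parity claims (a) and (b) assume that σ changes sign at each of its zeros; without this they fail, e.g. φ = π/2 − (1 − cos α) has total rotation 0 but σ has exactly one, tangential, zero. *)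

theory Defs
  imports "HOL-Complex_Analysis.Complex_Analysis" "HOL-Library.Z2"
begin

(* Conventions.  Objects over the circle are written on its universal cover, the real line with
   angular coordinate \<alpha>, as objects that are equivariant under \<alpha> \<mapsto> \<alpha> + 2 pi.  The bundle of rank CARD('n)
   with clutching matrix g is the quotient of the product of the line and real ^ 'n by
   (\<alpha>, v) ~ (\<alpha> + 2 pi, g v); every real vector bundle over the circle has this form, and the
   structure group is O(n) if g is orthogonal.  A section is a continuous u with
   u (\<alpha> + 2 pi) = g u(\<alpha>). *)

(* A family of invertible matrices on the line that is compatible with the two identifications. *)
definition bundle_iso :: "real^'n^'n \<Rightarrow> real^'n^'n \<Rightarrow> bool" where
  "bundle_iso g h \<longleftrightarrow> (\<exists>A :: real \<Rightarrow> real^'n^'n. continuous_on UNIV A \<and>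
     (\<forall>\<alpha>. invertible (A \<alpha>) \<and> A (\<alpha> + 2 * pi) ** g = h ** A \<alpha>))"

definition trivial_bundle :: "real^'n^'n \<Rightarrow> bool" where
  "trivial_bundle g \<longleftrightarrow> bundle_iso g (mat 1)"

(* On the line itself every line bundle is trivial, so local triviality amounts to a global frame u
   on the line, on which no equivariance is imposed. *)
definition line_subbundle :: "real^'n^'n \<Rightarrow> (real \<Rightarrow> (real^'n) set) \<Rightarrow> bool" where
  "line_subbundle g L \<longleftrightarrow>
     (\<exists>u :: real \<Rightarrow> real^'n. continuous_on UNIV u \<and> (\<forall>\<alpha>. u \<alpha> \<noteq> 0 \<and> L \<alpha> = span {u \<alpha>})) \<and>
     (\<forall>\<alpha>. L (\<alpha> + 2 * pi) = (\<lambda>v. g *v v) ` L \<alpha>)"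

(* For c = 1 or c = -1: (\<alpha>, t) \<mapsto> t u(\<alpha>) is an isomorphism onto L from the rank-one bundle
   (\<alpha>, t) ~ (\<alpha> + 2 pi, c t), which is the product bundle for c = 1 and the Moebius bundle
   for c = -1. *)
definition line_clutching :: "real^'n^'n \<Rightarrow> (real \<Rightarrow> (real^'n) set) \<Rightarrow> real \<Rightarrow> bool" where
  "line_clutching g L c \<longleftrightarrow> (\<exists>u :: real \<Rightarrow> real^'n. continuous_on UNIV u \<and>
     (\<forall>\<alpha>. u \<alpha> \<noteq> 0 \<and> u \<alpha> \<in> L \<alpha> \<and> u (\<alpha> + 2 * pi) = c *\<^sub>R (g *v u \<alpha>)))"

definition orientable_line :: "real^'n^'n \<Rightarrow> (real \<Rightarrow> (real^'n) set) \<Rightarrow> bool" where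
  "orientable_line g L \<longleftrightarrow> line_clutching g L 1"

definition moebius_line :: "real^'n^'n \<Rightarrow> (real \<Rightarrow> (real^'n) set) \<Rightarrow> bool" where
  "moebius_line g L \<longleftrightarrow> line_clutching g L (-1)"

(* A continuous angle on [0, 2 pi] whose total rotation is a multiple of pi extends uniquely to the
   line in this way; k pi is the total rotation. *)
definition fibre_angle :: "(real \<Rightarrow> real) \<Rightarrow> bool" where
  "fibre_angle \<phi> \<longleftrightarrow> continuous_on UNIV \<phi> \<and>
     (\<exists>k::int. \<forall>\<alpha>. \<phi> (\<alpha> + 2 * pi) = \<phi> \<alpha> + of_int k * pi)"

definition sec :: "real \<Rightarrow> (real \<Rightarrow> real) \<Rightarrow> real \<Rightarrow> real^2" where
  "sec r \<phi> \<alpha> = r *\<^sub>R vector [cos (\<phi> \<alpha>), sin (\<phi> \<alpha>)]"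

definition line_of :: "(real \<Rightarrow> real^2) \<Rightarrow> real \<Rightarrow> (real^2) set" where
  "line_of s \<alpha> = span {s \<alpha>}"

(* The row vector of the fibrewise linear functional. *)
definition readout :: "real^2" where
  "readout = vector [1, 0]"

definition sigma :: "real \<Rightarrow> (real \<Rightarrow> real) \<Rightarrow> real \<Rightarrow> real" where
  "sigma r \<phi> \<alpha> = readout \<bullet> sec r \<phi> \<alpha>"

definition zeros :: "(real \<Rightarrow> real) \<Rightarrow> real set" where
  "zeros f = {\<alpha> \<in> {0..<2 * pi}. f \<alpha> = 0}"

(* f has opposite strict signs on the two sides of a; for differentiable f with f(a) = 0 this
   follows from f'(a) \<noteq> 0. *)
definition changes_sign_at :: "(real \<Rightarrow> real) \<Rightarrow> real \<Rightarrow> bool" where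
  "changes_sign_at f a \<longleftrightarrow>
     (\<exists>\<epsilon>>0. \<forall>t u. 0 < t \<and> t < \<epsilon> \<and> 0 < u \<and> u < \<epsilon> \<longrightarrow> f (a - t) * f (a + u) < 0)"

(* Without this the parity of the number of zeros is not determined: the angle
   pi/2 - (1 - cos \<alpha>) has total rotation 0, but a single, tangential zero. *)
definition transversal_zeros :: "(real \<Rightarrow> real) \<Rightarrow> bool" where
  "transversal_zeros f \<longleftrightarrow> (\<forall>a \<in> zeros f. changes_sign_at f a)"

(* The homeomorphism of the real projective line onto the unit circle, [z] \<mapsto> (z / |z|)^2 with the
   plane identified with the complex numbers. *)
definition rp1_circle :: "(real^2) set \<Rightarrow> complex" where
  "rp1_circle l = (THE w. \<exists>v\<in>l. v \<noteq> 0 \<and> w = (sgn (Complex (v $ 1) (v $ 2)))\<^sup>2)"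

(* The degree of a 2 pi-periodic line field as a map from the circle to the projective line.  The
   winding number of a closed path is an integer, so floor only changes the type. *)
definition line_degree :: "(real \<Rightarrow> (real^2) set) \<Rightarrow> int" where
  "line_degree L = \<lfloor>Re (winding_number (\<lambda>t. rp1_circle (L (2 * pi * t))) 0)\<rfloor>"

(* Values are in Z_2, under the unique isomorphism of the first cohomology of the circle with
   coefficients in Z_2 with Z_2. *)
definition w1 :: "(real \<Rightarrow> (real^2) set) \<Rightarrow> bit" where
  "w1 L = of_int (line_degree L)"

definition J :: "real^2^2" where
  "J = vector [vector [0, -1], vector [1, 0]]"

definition smooth :: "(real \<Rightarrow> real) \<Rightarrow> bool" where
  "smooth f \<longleftrightarrow> (\<forall>n. (deriv ^^ n) f differentiable_on UNIV)"

(* \<theta> \<alpha> v is the value of the form at the point \<alpha> on the tangent vector v. *)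
definition one_form :: "(real \<Rightarrow> real \<Rightarrow> real) \<Rightarrow> bool" where
  "one_form \<theta> \<longleftrightarrow> (\<forall>\<alpha>. linear (\<theta> \<alpha>) \<and> \<theta> (\<alpha> + 2 * pi) = \<theta> \<alpha>) \<and> smooth (\<lambda>\<alpha>. \<theta> \<alpha> 1)"

definition ext_deriv :: "(real \<Rightarrow> real \<Rightarrow> real) \<Rightarrow> real \<Rightarrow> real \<Rightarrow> real \<Rightarrow> real" where
  "ext_deriv \<theta> \<alpha> u v =
     frechet_derivative (\<lambda>\<beta>. \<theta> \<beta> v) (at \<alpha>) u - frechet_derivative (\<lambda>\<beta>. \<theta> \<beta> u) (at \<alpha>) v"

(* d + \<theta> J defines a connection on the bundle with clutching matrix g, that is, it maps
   sections to sections. *)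
definition is_connection :: "real^2^2 \<Rightarrow> (real \<Rightarrow> real \<Rightarrow> real) \<Rightarrow> bool" where
  "is_connection g \<theta> \<longleftrightarrow> one_form \<theta> \<and> g ** J = J ** g"

definition curvature :: "(real \<Rightarrow> real \<Rightarrow> real) \<Rightarrow> real \<Rightarrow> real \<Rightarrow> real \<Rightarrow> real^2^2" where
  "curvature \<theta> \<alpha> u v = ext_deriv \<theta> \<alpha> u v *\<^sub>R J"

definition flat :: "(real \<Rightarrow> real \<Rightarrow> real) \<Rightarrow> bool" where
  "flat \<theta> \<longleftrightarrow> (\<forall>\<alpha> u v. curvature \<theta> \<alpha> u v = 0)"

(* ds + \<theta> J s = 0 *)
definition parallel :: "(real \<Rightarrow> real \<Rightarrow> real) \<Rightarrow> (real \<Rightarrow> real^2) \<Rightarrow> bool" where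
  "parallel \<theta> s \<longleftrightarrow> (\<forall>\<alpha>. (s has_derivative (\<lambda>v. - (\<theta> \<alpha> v *\<^sub>R (J *v s \<alpha>)))) (at \<alpha>))"

definition minus_d :: "(real \<Rightarrow> real) \<Rightarrow> real \<Rightarrow> real \<Rightarrow> real" where
  "minus_d \<phi> \<alpha> v = - frechet_derivative \<phi> (at \<alpha>) v"

end

theory Submission
  imports Defs
begin

text \<open>
  A matrix that commutes with \<open>J\<close> is a complex number acting on the plane, and it is determined by
  its first row.  Since the readout fixes the first row to be \<open>(1, 0)\<close>, the clutching matrix is the
  identity (\<open>clutching_matrix_is_identity\<close>): the ambient bundle is the product bundle, and
  all twisting sits in the line field.

  Let \<open>k\<pi>\<close> be the total rotation of the fibre angle.  After one turn the section, and with it \<open>\<sigma>\<close>,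
  is multiplied by \<open>(-1)^k\<close>, and everything depends on this sign.

  The circle coordinate of the line at angle \<open>\<phi>\<close> is \<open>exp (2 \<i> \<phi>)\<close>, so the degree of the line field is
  \<open>k\<close> and its class is \<open>k mod 2\<close> (\<open>w1_line_of_sec\<close>).  A continuous nowhere vanishing \<open>u\<close> in the line
  field is a multiple \<open>t s\<close> of the section, where \<open>t\<close> has constant sign by the intermediate value
  theorem; so the clutching constant of the line bundle can only be \<open>(-1)^k\<close>
  (\<open>line_clutching_iff\<close>).  A function that is multiplied by \<open>(-1)^k\<close> after one turn and changes sign
  at each of its zeros has a number of zeros of the same parity as \<open>k\<close>
  (\<open>zeros_parity_of_sign_periodic\<close>).  For odd \<open>k\<close> the intermediate value theorem forces a zero, and the
  angle \<open>\<alpha> / 2\<close> has no other.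

  Flatness is automatic because a two-form on a one-dimensional manifold vanishes
  (\<open>one_form_flat\<close>), and the angles \<open>0\<close> and \<open>\<alpha> / 2\<close> realise the two classes.
\<close>

(* the symbol $ below always selects a component of a vector *)
no_notation fps_nth (infixl "$" 75)

section \<open>The ambient bundle\<close>

text \<open>Commuting with \<open>J\<close> means that the matrix has the form of a complex number \<open>a + b\<i>\<close>, and the
  first row \<open>(a, -b)\<close> is what the readout sees.\<close>

lemma clutching_matrix_is_identity:
  fixes g :: "real^2^2"
  assumes "readout v* g = readout" and "g ** J = J ** g"
  shows "g = mat 1"
proof -
  have row: "g$1$1 = 1" "g$1$2 = 0"
    using assms(1)
    by (auto simp: readout_def vector_matrix_mult_def vec_eq_iff sum_2 forall_2)
  have "g$2$1 = - (g$1$2)" "g$2$2 = g$1$1"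
    using arg_cong[OF assms(2), of "\<lambda>m. m$1$1"] arg_cong[OF assms(2), of "\<lambda>m. m$1$2"]
    by (simp_all add: J_def matrix_matrix_mult_def sum_2)
  with row show ?thesis
    by (simp add: vec_eq_iff forall_2 mat_def)
qed

lemma trivial_bundle_identity: "trivial_bundle (mat 1 :: real^'n^'n)"
  unfolding trivial_bundle_def bundle_iso_def
  by (intro exI[of _ "\<lambda>_. mat 1"]) (auto simp: invertible_def intro!: exI[of _ "mat 1"])

section \<open>The section after one turn\<close>

text \<open>This is \<open>(-1)^k\<close>, written by parity because \<open>k\<close> may be negative.\<close>

definition turn_sign :: "int \<Rightarrow> real" where
  "turn_sign k = (if even k then 1 else -1)"

lemma sigma_eq: "sigma r \<phi> \<alpha> = r * cos (\<phi> \<alpha>)"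
  by (simp add: sigma_def sec_def readout_def inner_vec_def sum_2)

lemma sec_basis:
  "sec r \<phi> \<alpha> = (r * cos (\<phi> \<alpha>)) *\<^sub>R vector [1, 0] + (r * sin (\<phi> \<alpha>)) *\<^sub>R vector [0, 1]"
  by (simp add: sec_def vec_eq_iff forall_2)

lemma sec_turn:
  assumes "\<phi> (\<alpha> + 2 * pi) = \<phi> \<alpha> + of_int k * pi"
  shows "sec r \<phi> (\<alpha> + 2 * pi) = turn_sign k *\<^sub>R sec r \<phi> \<alpha>"
proof -
  have "cos (of_int k * pi) = turn_sign k" "sin (of_int k * pi) = 0"
    using cos_npi_int[of k] sin_npi_int[of k] by (simp_all add: turn_sign_def mult.commute)
  then show ?thesis
    using assms by (simp add: sec_def vec_eq_iff forall_2 cos_add sin_add)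
qed

lemma sigma_turn:
  assumes "\<phi> (\<alpha> + 2 * pi) = \<phi> \<alpha> + of_int k * pi"
  shows "sigma r \<phi> (\<alpha> + 2 * pi) = turn_sign k * sigma r \<phi> \<alpha>"
  using sec_turn[OF assms] by (simp add: sigma_def)

lemma sec_nonzero: "r \<noteq> 0 \<Longrightarrow> sec r \<phi> \<alpha> \<noteq> 0"
  using sin_zero_abs_cos_one[of "\<phi> \<alpha>"] by (auto simp: sec_def vec_eq_iff forall_2)

lemma continuous_sec:
  assumes "continuous_on UNIV \<phi>"
  shows "continuous_on UNIV (sec r \<phi>)"
  unfolding sec_basis[abs_def] using assms by (intro continuous_intros)

lemma continuous_sigma:
  assumes "continuous_on UNIV \<phi>"
  shows "continuous_on UNIV (sigma r \<phi>)"
  unfolding sigma_eq using assms by (intro continuous_intros)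

section \<open>The class of the line field\<close>

text \<open>Squaring removes the choice of a direction on the line and doubles its angle.\<close>

lemma rp1_circle_line_of_sec:
  assumes "r \<noteq> 0"
  shows "rp1_circle (line_of (sec r \<phi>) \<alpha>) = exp (\<i> * of_real (2 * \<phi> \<alpha>))"
proof -
  let ?s = "sec r \<phi> \<alpha>"
  have square: "(sgn (Complex ((c *\<^sub>R ?s) $ 1) ((c *\<^sub>R ?s) $ 2)))\<^sup>2 = exp (\<i> * of_real (2 * \<phi> \<alpha>))"
    if "c \<noteq> 0" for c
  proof -
    have "Complex ((c *\<^sub>R ?s) $ 1) ((c *\<^sub>R ?s) $ 2) = (c * r) *\<^sub>R cis (\<phi> \<alpha>)"
      by (simp add: sec_def complex_eq_iff)
    then have "sgn (Complex ((c *\<^sub>R ?s) $ 1) ((c *\<^sub>R ?s) $ 2)) = sgn (c * r) *\<^sub>R cis (\<phi> \<alpha>)"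
      by (simp only: sgn_scaleR sgn_cis)
    then have "(sgn (Complex ((c *\<^sub>R ?s) $ 1) ((c *\<^sub>R ?s) $ 2)))\<^sup>2 = (sgn (c * r))\<^sup>2 *\<^sub>R (cis (\<phi> \<alpha>))\<^sup>2"
      by (simp only: scaleR_power)
    also have "(sgn (c * r))\<^sup>2 = 1"
      using that assms by (auto simp: sgn_real_def)
    also have "(cis (\<phi> \<alpha>))\<^sup>2 = exp (\<i> * of_real (2 * \<phi> \<alpha>))"
      by (simp only: Complex.DeMoivre of_nat_numeral) (simp add: cis_conv_exp)
    finally show ?thesis by simp
  qed
  show ?thesis
    unfolding rp1_circle_def line_of_def
  proof (rule the_equality)
    show "\<exists>v\<in>span {?s}. v \<noteq> 0 \<and>
        exp (\<i> * of_real (2 * \<phi> \<alpha>)) = (sgn (Complex (v $ 1) (v $ 2)))\<^sup>2"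
      using square[of 1] sec_nonzero[OF assms, of \<phi> \<alpha>]
      by (intro bexI[of _ ?s]) (auto simp: span_base)
  next
    fix w
    assume "\<exists>v\<in>span {?s}. v \<noteq> 0 \<and> w = (sgn (Complex (v $ 1) (v $ 2)))\<^sup>2"
    then obtain c where "c *\<^sub>R ?s \<noteq> 0"
      "w = (sgn (Complex ((c *\<^sub>R ?s) $ 1) ((c *\<^sub>R ?s) $ 2)))\<^sup>2"
      by (auto simp: span_singleton)
    with square[of c] show "w = exp (\<i> * of_real (2 * \<phi> \<alpha>))" by auto
  qed
qed

lemma line_degree_line_of_sec:
  assumes "r \<noteq> 0" and cont: "continuous_on UNIV \<phi>"
    and turn: "\<And>\<alpha>. \<phi> (\<alpha> + 2 * pi) = \<phi> \<alpha> + of_int k * pi"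
  shows "line_degree (line_of (sec r \<phi>)) = k"
proof -
  define p where "p = (\<lambda>t::real. \<i> * of_real (2 * \<phi> (2 * pi * t)))"
  have "path p"
    unfolding path_def p_def
    by (intro continuous_intros continuous_on_compose2[OF cont]) auto
  then have "winding_number (exp \<circ> p) 0 = (p 1 - p 0) / (2 * of_real pi * \<i>)"
    using winding_number_compose_exp[of p] by (simp add: pathfinish_def pathstart_def)
  also have "\<dots> = of_int k"
    using turn[of 0] by (simp add: p_def field_simps)
  finally have "winding_number (exp \<circ> p) 0 = of_int k" .
  moreover have "(\<lambda>t. rp1_circle (line_of (sec r \<phi>) (2 * pi * t))) = exp \<circ> p"
    by (auto simp: rp1_circle_line_of_sec[OF assms(1)] p_def)
  ultimately show ?thesis
    by (simp add: line_degree_def)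
qed

lemma bit_of_int_eq_0_iff: "(of_int k :: bit) = 0 \<longleftrightarrow> even k"
  by (cases "even k") (auto elim!: evenE oddE)

lemma bit_of_nat_eq_0_iff: "(of_nat n :: bit) = 0 \<longleftrightarrow> even n"
  using bit_of_int_eq_0_iff[of "int n"] by simp

lemma w1_line_of_sec:
  assumes "r \<noteq> 0" and "continuous_on UNIV \<phi>"
    and "\<And>\<alpha>. \<phi> (\<alpha> + 2 * pi) = \<phi> \<alpha> + of_int k * pi"
  shows "w1 (line_of (sec r \<phi>)) = 0 \<longleftrightarrow> even k"
  using line_degree_line_of_sec[OF assms] by (simp add: w1_def bit_of_int_eq_0_iff)

section \<open>The isomorphism type of the line bundle\<close>

lemma line_subbundle_line_of_sec:
  assumes "r \<noteq> 0" and cont: "continuous_on UNIV \<phi>"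
    and turn: "\<And>\<alpha>. \<phi> (\<alpha> + 2 * pi) = \<phi> \<alpha> + of_int k * pi"
  shows "line_subbundle (mat 1) (line_of (sec r \<phi>))"
proof -
  have "line_of (sec r \<phi>) (\<alpha> + 2 * pi) = line_of (sec r \<phi>) \<alpha>" for \<alpha>
  proof -
    have "span {- v} = span {v}" for v :: "real^2"
      using span_neg[OF span_base[of "- v" "{- v}"]] span_neg[OF span_base[of v "{v}"]]
      by (simp add: span_eq)
    then show ?thesis
      by (simp add: line_of_def sec_turn[of \<phi>, OF turn] turn_sign_def)
  qed
  then show ?thesis
    unfolding line_subbundle_def
    using continuous_sec[OF cont, of r] sec_nonzero[OF assms(1), of \<phi>]
    by (auto simp: line_of_def)
qed

lemma nonvanishing_constant_sign:
  fixes f :: "real \<Rightarrow> real"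
  assumes "a \<le> b" and "continuous_on {a..b} f" and "\<And>x. x \<in> {a..b} \<Longrightarrow> f x \<noteq> 0"
  shows "f a * f b > 0"
proof (rule ccontr)
  assume "\<not> f a * f b > 0"
  then have "f a \<le> 0 \<and> 0 \<le> f b \<or> f b \<le> 0 \<and> 0 \<le> f a"
    by (auto simp: not_less mult_le_0_iff)
  then obtain x where "x \<in> {a..b}" "f x = 0"
    using IVT'[of f a 0 b] IVT2'[of f b 0 a] assms(1,2) by fastforce
  then show False using assms(3) by blast
qed

text \<open>A frame of the line field is \<open>t s\<close> for a continuous nowhere vanishing function \<open>t\<close>, which
  cannot absorb the sign that the section acquires.\<close>

lemma line_clutching_iff:
  assumes "r \<noteq> 0" and cont: "continuous_on UNIV \<phi>"
    and turn: "\<And>\<alpha>. \<phi> (\<alpha> + 2 * pi) = \<phi> \<alpha> + of_int k * pi"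
    and c: "c = 1 \<or> c = -1"
  shows "line_clutching (mat 1) (line_of (sec r \<phi>)) c \<longleftrightarrow> c = turn_sign k"
proof
  assume "c = turn_sign k"
  then show "line_clutching (mat 1) (line_of (sec r \<phi>)) c"
    unfolding line_clutching_def
    using continuous_sec[OF cont, of r] sec_nonzero[OF assms(1), of \<phi>]
    by (intro exI[of _ "sec r \<phi>"]) (auto simp: line_of_def span_base sec_turn[of \<phi>, OF turn])
next
  assume "line_clutching (mat 1) (line_of (sec r \<phi>)) c"
  then obtain u where u: "continuous_on UNIV u" "\<And>\<alpha>. u \<alpha> \<noteq> 0"
    "\<And>\<alpha>. u \<alpha> \<in> span {sec r \<phi> \<alpha>}" "\<And>\<alpha>. u (\<alpha> + 2 * pi) = c *\<^sub>R u \<alpha>"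
    by (auto simp: line_clutching_def line_of_def)
  (* up to the factor r^2, this is the coefficient of u with respect to the section *)
  define t where "t = (\<lambda>\<alpha>. u \<alpha> \<bullet> sec r \<phi> \<alpha>)"
  have "continuous_on UNIV t"
    unfolding t_def by (intro continuous_intros u(1) continuous_sec[OF cont])
  moreover have "t \<alpha> \<noteq> 0" for \<alpha>
  proof -
    obtain b where "u \<alpha> = b *\<^sub>R sec r \<phi> \<alpha>"
      using u(3)[of \<alpha>] by (auto simp: span_singleton)
    with u(2)[of \<alpha>] show ?thesis by (auto simp: t_def)
  qed
  ultimately have "t 0 * t (0 + 2 * pi) > 0"
    by (intro nonvanishing_constant_sign[where f = t]) (auto intro: continuous_on_subset)
  moreover have "t (0 + 2 * pi) = c * turn_sign k * t 0"
    unfolding t_def u(4) sec_turn[of \<phi>, OF turn] by simp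
  ultimately have "c * turn_sign k * (t 0)\<^sup>2 > 0"
    by (simp add: power2_eq_square mult_ac)
  then have "c * turn_sign k > 0"
    by (simp add: zero_less_mult_iff)
  with c show "c = turn_sign k"
    by (auto simp: turn_sign_def split: if_splits)
qed

section \<open>Counting sign changes\<close>

lemma changes_sign_at_isolated:
  assumes "changes_sign_at f a"
  obtains e where "e > 0" and "\<And>t u. 0 < t \<Longrightarrow> t < e \<Longrightarrow> 0 < u \<Longrightarrow> u < e \<Longrightarrow> f (a - t) * f (a + u) < 0"
    and "\<And>x. x \<noteq> a \<Longrightarrow> \<bar>x - a\<bar> < e \<Longrightarrow> f x \<noteq> 0"
proof -
  obtain e where e: "e > 0"
    "\<And>t u. 0 < t \<Longrightarrow> t < e \<Longrightarrow> 0 < u \<Longrightarrow> u < e \<Longrightarrow> f (a - t) * f (a + u) < 0"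
    using assms by (auto simp: changes_sign_at_def)
  have "f x \<noteq> 0" if "x \<noteq> a" "\<bar>x - a\<bar> < e" for x
    using that e(2)[of "\<bar>x - a\<bar>" "\<bar>x - a\<bar>"] by (cases "x < a") auto
  with e that show thesis by blast
qed

lemma finite_zeros_of_sign_changes:
  fixes f :: "real \<Rightarrow> real"
  assumes cont: "continuous_on {a..b} f"
    and change: "\<And>x. x \<in> {a..b} \<Longrightarrow> f x = 0 \<Longrightarrow> changes_sign_at f x"
  shows "finite {x \<in> {a..b}. f x = 0}" (is "finite ?Z")
proof (rule ccontr)
  assume "infinite ?Z"
  have "closed ?Z"
    using continuous_closed_preimage_constant[OF cont, of 0] by simp
  moreover have "bounded ?Z"
    by (rule bounded_subset[of "{a..b}"]) auto
  ultimately have "compact ?Z"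
    by (simp add: compact_eq_bounded_closed)
  with \<open>infinite ?Z\<close> obtain z where z: "z \<in> ?Z" "z islimpt ?Z"
    unfolding compact_eq_Bolzano_Weierstrass by blast
  then obtain e where "e > 0" "\<And>x. x \<noteq> z \<Longrightarrow> \<bar>x - z\<bar> < e \<Longrightarrow> f x \<noteq> 0"
    using changes_sign_at_isolated[OF change] by (metis (mono_tags, lifting) mem_Collect_eq)
  with z(2) show False
    unfolding islimpt_approachable dist_real_def by blast
qed

text \<open>The sign is flipped at each zero and kept in between.  The induction removes the last zero.\<close>

lemma parity_of_sign_changes:
  fixes f :: "real \<Rightarrow> real"
  assumes "a \<le> b" and "continuous_on {a..b} f" and "f a \<noteq> 0" and "f b \<noteq> 0"
    and "\<And>x. x \<in> {a..b} \<Longrightarrow> f x = 0 \<Longrightarrow> changes_sign_at f x"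
  shows "even (card {x \<in> {a..b}. f x = 0}) \<longleftrightarrow> f a * f b > 0"
  using assms
proof (induction "card {x \<in> {a..b}. f x = 0}" arbitrary: b)
  case 0
  have "finite {x \<in> {a..b}. f x = 0}"
    using 0 by (intro finite_zeros_of_sign_changes)
  with 0(1) have "\<And>x. x \<in> {a..b} \<Longrightarrow> f x \<noteq> 0" by auto
  with 0 nonvanishing_constant_sign[of a b f] show ?case by simp
next
  case (Suc n)
  let ?Z = "{x \<in> {a..b}. f x = 0}"
  have fin: "finite ?Z"
    using Suc.prems by (intro finite_zeros_of_sign_changes)
  define z where "z = Max ?Z"
  have "?Z \<noteq> {}" using Suc.hyps(2) by (metis card.empty nat.distinct(1))
  then have z: "z \<in> ?Z" and last: "\<And>x. x \<in> ?Z \<Longrightarrow> x \<le> z"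
    using Max_in[OF fin] Max_ge[OF fin] by (auto simp: z_def)
  then have "a < z" "z < b" "f z = 0"
    using Suc.prems(3,4) by (auto simp: less_le)
  obtain e where e: "e > 0"
    "\<And>t u. 0 < t \<Longrightarrow> t < e \<Longrightarrow> 0 < u \<Longrightarrow> u < e \<Longrightarrow> f (z - t) * f (z + u) < 0"
    "\<And>x. x \<noteq> z \<Longrightarrow> \<bar>x - z\<bar> < e \<Longrightarrow> f x \<noteq> 0"
    using changes_sign_at_isolated Suc.prems(5)[of z] z by auto
  define d where "d = min (e / 2) (min (z - a) (b - z))"
  have d: "0 < d" "d < e" "a \<le> z - d" "z + d \<le> b"
    using \<open>e > 0\<close> \<open>a < z\<close> \<open>z < b\<close> by (auto simp: d_def min_def)
  have flip: "f (z - d) * f (z + d) < 0" using e(2) d by blast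
  have "{x \<in> {a..z - d}. f x = 0} = ?Z - {z}"
  proof (intro equalityI subsetI)
    fix x assume "x \<in> ?Z - {z}"
    moreover have "x \<le> z - d"
    proof (rule ccontr)
      assume "\<not> x \<le> z - d"
      with last[of x] e(3)[of x] d \<open>x \<in> ?Z - {z}\<close> show False by auto
    qed
    ultimately show "x \<in> {x \<in> {a..z - d}. f x = 0}" by auto
  qed (use d \<open>z < b\<close> in auto)
  then have less: "card {x \<in> {a..z - d}. f x = 0} = n"
    using Suc.hyps(2) z fin by (simp add: card_Diff_singleton)
  have "even (card {x \<in> {a..z - d}. f x = 0}) \<longleftrightarrow> f a * f (z - d) > 0"
  proof (rule Suc.hyps(1))
    show "n = card {x \<in> {a..z - d}. f x = 0}" using less by simp
    show "continuous_on {a..z - d} f"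
      using d by (intro continuous_on_subset[OF Suc.prems(2)]) auto
    show "f (z - d) \<noteq> 0" using flip by auto
  qed (use d Suc.prems in auto)
  moreover have "f (z + d) * f b > 0"
  proof (rule nonvanishing_constant_sign[where f = f])
    show "continuous_on {z + d..b} f"
      using d \<open>a < z\<close> by (intro continuous_on_subset[OF Suc.prems(2)]) auto
    show "f x \<noteq> 0" if "x \<in> {z + d..b}" for x
      using last[of x] that d \<open>a < z\<close> by auto
  qed (use d in auto)
  ultimately show ?case
    using flip less Suc.hyps(2)[symmetric] Suc.prems(3)
    by (auto simp: zero_less_mult_iff mult_less_0_iff)
qed

lemma changes_sign_at_turn:
  assumes "\<And>x. f (x + p) = c * f x" and "c = 1 \<or> c = -1" and "changes_sign_at f a"
  shows "changes_sign_at f (a + p)" and "changes_sign_at f (a - p)"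
proof -
  have "f (a + p - t) * f (a + p + u) = f (a - t) * f (a + u)" for t u
    using assms(1)[of "a - t"] assms(1)[of "a + u"] assms(2) by (auto simp: algebra_simps)
  with assms(3) show "changes_sign_at f (a + p)" by (simp add: changes_sign_at_def)
  have "f (a - t) * f (a + u) = f (a - p - t) * f (a - p + u)" for t u
    using assms(1)[of "a - p - t"] assms(1)[of "a - p + u"] assms(2) by (auto simp: algebra_simps)
  with assms(3) show "changes_sign_at f (a - p)" by (simp add: changes_sign_at_def)
qed

text \<open>If \<open>f\<close> vanishes at the base point, its signs at the two ends of the fundamental interval are
  not defined.  In that case the interval is moved back by an amount \<open>d\<close>, so small that the zeros
  remain the same and all lie in the interior.\<close>

lemma zeros_parity_of_sign_periodic:
  fixes f :: "real \<Rightarrow> real"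
  assumes cont: "continuous_on UNIV f" and turn: "\<And>x. f (x + 2 * pi) = c * f x"
    and c: "c = 1 \<or> c = -1" and trans: "transversal_zeros f"
  shows "finite (zeros f)" and "even (card (zeros f)) \<longleftrightarrow> c = 1"
proof -
  have "\<exists>d. 0 \<le> d \<and> d < 2 * pi \<and> f (-d) \<noteq> 0 \<and> (\<forall>x. -d \<le> x \<and> x < 0 \<longrightarrow> f x \<noteq> 0)"
  proof (cases "f 0 = 0")
    case True
    then have "changes_sign_at f 0"
      using trans by (auto simp: transversal_zeros_def zeros_def)
    then obtain e where "e > 0" "\<And>x. x \<noteq> 0 \<Longrightarrow> \<bar>x - 0\<bar> < e \<Longrightarrow> f x \<noteq> 0"
      using changes_sign_at_isolated by metis
    then show ?thesis
      using pi_gt_zero by (intro exI[of _ "min (e / 2) pi"]) (auto simp: min_def)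
  next
    case False
    then show ?thesis using pi_gt_zero by (intro exI[of _ 0]) auto
  qed
  then obtain d where d: "0 \<le> d" "d < 2 * pi" "f (-d) \<noteq> 0"
    "\<And>x. -d \<le> x \<Longrightarrow> x < 0 \<Longrightarrow> f x \<noteq> 0" by blast
  have end_eq: "f (2 * pi - d) = c * f (-d)"
    using turn[of "-d"] by (simp add: add.commute)
  then have end_nz: "f (2 * pi - d) \<noteq> 0" using d c by auto
  have Z: "{x \<in> {-d..2 * pi - d}. f x = 0} = zeros f"
  proof (intro equalityI subsetI)
    fix x assume x: "x \<in> {x \<in> {-d..2 * pi - d}. f x = 0}"
    then have "0 \<le> x" using d(4)[of x] by force
    moreover have "x \<noteq> 2 * pi - d" using x end_nz by auto
    ultimately show "x \<in> zeros f" using x d(1) by (auto simp: zeros_def)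
  next
    fix x assume x: "x \<in> zeros f"
    have "x \<le> 2 * pi - d"
    proof (rule ccontr)
      assume "\<not> x \<le> 2 * pi - d"
      with d(4)[of "x - 2 * pi"] turn[of "x - 2 * pi"] x c show False
        by (auto simp: zeros_def)
    qed
    with x d(1) show "x \<in> {x \<in> {-d..2 * pi - d}. f x = 0}" by (auto simp: zeros_def)
  qed
  have change: "changes_sign_at f x" if "x \<in> {-d..2 * pi - d}" "f x = 0" for x
    using that Z trans by (auto simp: transversal_zeros_def)
  have cont': "continuous_on {-d..2 * pi - d} f"
    using cont by (rule continuous_on_subset) auto
  show "finite (zeros f)"
    unfolding Z[symmetric] by (rule finite_zeros_of_sign_changes[OF cont' change])
  have "even (card (zeros f)) \<longleftrightarrow> f (-d) * f (2 * pi - d) > 0"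
    unfolding Z[symmetric]
    by (rule parity_of_sign_changes[OF _ cont' d(3) end_nz change]) auto
  also have "\<dots> \<longleftrightarrow> c * (f (-d))\<^sup>2 > 0"
    unfolding end_eq by (simp add: power2_eq_square mult.left_commute)
  also have "\<dots> \<longleftrightarrow> c = 1"
    using c d(3) by (auto simp: zero_less_mult_iff)
  finally show "even (card (zeros f)) \<longleftrightarrow> c = 1" .
qed

lemma zeros_nonempty_of_antiperiodic:
  fixes f :: "real \<Rightarrow> real"
  assumes cont: "continuous_on UNIV f" and turn: "\<And>x. f (x + 2 * pi) = - f x"
  shows "zeros f \<noteq> {}"
proof
  assume empty: "zeros f = {}"
  have end_eq: "f (2 * pi) = - f 0" using turn[of 0] by simp
  have nz: "f x \<noteq> 0" if "x \<in> {0..2 * pi}" for x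
  proof (cases "x = 2 * pi")
    case True
    then show ?thesis using empty end_eq by (force simp: zeros_def)
  next
    case False
    then show ?thesis using empty that by (force simp: zeros_def)
  qed
  have "f 0 * f (2 * pi) > 0"
    by (rule nonvanishing_constant_sign[where f = f]) (use cont nz in \<open>auto intro: continuous_on_subset\<close>)
  then show False
    by (simp add: end_eq zero_less_mult_iff)
qed

section \<open>Flat connections\<close>

text \<open>The exterior derivative is an alternating form in two tangent vectors, and the tangent space is
  one-dimensional.\<close>

lemma one_form_flat:
  assumes "one_form \<theta>"
  shows "flat \<theta>"
proof -
  have lin: "\<theta> \<beta> v = v *\<^sub>R \<theta> \<beta> 1" for \<beta> v
    using assms linear_cmul[of "\<theta> \<beta>" v 1] by (simp add: one_form_def)
  have "smooth (\<lambda>\<beta>. \<theta> \<beta> 1)" using assms by (simp add: one_form_def)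
  then have "(\<lambda>\<beta>. \<theta> \<beta> 1) differentiable_on UNIV"
    unfolding smooth_def by (metis funpow_0)
  then have "(\<lambda>\<beta>. \<theta> \<beta> 1) differentiable (at \<alpha>)" for \<alpha>
    by (auto simp: differentiable_on_def)
  then have D: "((\<lambda>\<beta>. \<theta> \<beta> 1) has_real_derivative deriv (\<lambda>\<beta>. \<theta> \<beta> 1) \<alpha>) (at \<alpha>)" for \<alpha>
    by (simp add: DERIV_deriv_iff_real_differentiable)
  have "frechet_derivative (\<lambda>\<beta>. \<theta> \<beta> v) (at \<alpha>) = (\<lambda>u. u * v * deriv (\<lambda>\<beta>. \<theta> \<beta> 1) \<alpha>)" for \<alpha> v
  proof (rule frechet_derivative_at[symmetric])
    have "((\<lambda>\<beta>. v * \<theta> \<beta> 1) has_derivative (\<lambda>u. v * (deriv (\<lambda>\<beta>. \<theta> \<beta> 1) \<alpha> * u))) (at \<alpha>)"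
      using D[of \<alpha>] unfolding has_field_derivative_def by (rule has_derivative_mult_right)
    then show "((\<lambda>\<beta>. \<theta> \<beta> v) has_derivative (\<lambda>u. u * v * deriv (\<lambda>\<beta>. \<theta> \<beta> 1) \<alpha>)) (at \<alpha>)"
      using lin[of _ v] by (simp add: mult_ac)
  qed
  then show ?thesis
    by (simp add: flat_def curvature_def ext_deriv_def mult_ac)
qed

lemma smooth_has_derivative:
  assumes "smooth \<phi>"
  shows "(\<phi> has_real_derivative deriv \<phi> \<alpha>) (at \<alpha>)"
proof -
  have "\<phi> differentiable_on UNIV"
    using assms unfolding smooth_def by (metis funpow_0)
  then show ?thesis
    by (auto simp: differentiable_on_def DERIV_deriv_iff_real_differentiable)
qed

lemma smooth_minus_deriv:
  assumes "smooth \<phi>"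
  shows "smooth (\<lambda>\<alpha>. - deriv \<phi> \<alpha>)"
proof -
  have D: "(deriv ^^ n) \<phi> field_differentiable at \<alpha>" for n \<alpha>
    using assms unfolding smooth_def differentiable_on_def field_differentiable_def
    by (metis DERIV_deriv_iff_real_differentiable UNIV_I)
  have "(deriv ^^ n) (\<lambda>\<alpha>. - deriv \<phi> \<alpha>) = (\<lambda>\<alpha>. - (deriv ^^ Suc n) \<phi> \<alpha>)" for n
  proof (induction n)
    case (Suc n)
    have "(deriv ^^ Suc n) (\<lambda>\<alpha>. - deriv \<phi> \<alpha>) = deriv (\<lambda>\<alpha>. - (deriv ^^ Suc n) \<phi> \<alpha>)"
      using Suc by simp
    also have "\<dots> = (\<lambda>\<alpha>. - (deriv ^^ Suc (Suc n)) \<phi> \<alpha>)"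
      using D[of "Suc n"] by (simp add: fun_eq_iff)
    finally show ?case .
  qed simp
  with assms show ?thesis
    unfolding smooth_def by (metis differentiable_on_minus)
qed

lemma minus_d_eq:
  assumes "smooth \<phi>"
  shows "minus_d \<phi> \<alpha> v = - (deriv \<phi> \<alpha> * v)"
proof -
  have "frechet_derivative \<phi> (at \<alpha>) = (*) (deriv \<phi> \<alpha>)"
    using smooth_has_derivative[OF assms, of \<alpha>] unfolding has_field_derivative_def
    by (rule frechet_derivative_at[symmetric])
  then show ?thesis by (simp add: minus_d_def)
qed

text \<open>The angle itself is not a function on the circle, but its differential is a form there because
  the angle grows by a constant in each turn.\<close>

lemma one_form_minus_d:
  assumes "smooth \<phi>" and turn: "\<And>\<alpha>. \<phi> (\<alpha> + 2 * pi) = \<phi> \<alpha> + of_int k * pi"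
  shows "one_form (minus_d \<phi>)"
proof -
  have periodic: "deriv \<phi> (\<alpha> + 2 * pi) = deriv \<phi> \<alpha>" for \<alpha>
  proof -
    have "((\<lambda>x. \<phi> (x + 2 * pi)) has_real_derivative deriv \<phi> (\<alpha> + 2 * pi)) (at \<alpha>)"
      using smooth_has_derivative[OF assms(1), of "\<alpha> + 2 * pi"] by (simp add: DERIV_shift)
    moreover have "((\<lambda>x. \<phi> (x + 2 * pi)) has_real_derivative deriv \<phi> \<alpha>) (at \<alpha>)"
      unfolding turn using smooth_has_derivative[OF assms(1), of \<alpha>]
      by (auto intro!: derivative_eq_intros)
    ultimately show ?thesis by (rule DERIV_unique)
  qed
  have "linear (minus_d \<phi> \<alpha>)" for \<alpha>
    by (rule linearI) (simp_all add: minus_d_eq[OF assms(1)] algebra_simps)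
  moreover have "minus_d \<phi> (\<alpha> + 2 * pi) = minus_d \<phi> \<alpha>" for \<alpha>
    by (simp add: fun_eq_iff minus_d_eq[OF assms(1)] periodic)
  moreover have "smooth (\<lambda>\<alpha>. minus_d \<phi> \<alpha> 1)"
    using smooth_minus_deriv[OF assms(1)] by (simp add: minus_d_eq[OF assms(1)])
  ultimately show ?thesis by (simp add: one_form_def)
qed

text \<open>Differentiating the section rotates it by a right angle: \<open>ds = d\<phi> J s\<close>.\<close>

lemma parallel_minus_d:
  assumes "smooth \<phi>"
  shows "parallel (minus_d \<phi>) (sec r \<phi>)"
  unfolding parallel_def
proof
  fix \<alpha>
  let ?D = "\<lambda>v. - (minus_d \<phi> \<alpha> v *\<^sub>R (J *v sec r \<phi> \<alpha>))"
  let ?B = "\<lambda>v. (v * - (r * sin (\<phi> \<alpha>) * deriv \<phi> \<alpha>)) *\<^sub>R (vector [1, 0] :: real^2)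
    + (v * (r * cos (\<phi> \<alpha>) * deriv \<phi> \<alpha>)) *\<^sub>R (vector [0, 1] :: real^2)"
  note D = smooth_has_derivative[OF assms, of \<alpha>]
  have "((\<lambda>x. r * cos (\<phi> x)) has_real_derivative - (r * sin (\<phi> \<alpha>) * deriv \<phi> \<alpha>)) (at \<alpha>)"
    and "((\<lambda>x. r * sin (\<phi> x)) has_real_derivative r * cos (\<phi> \<alpha>) * deriv \<phi> \<alpha>) (at \<alpha>)"
    using D by (auto intro!: derivative_eq_intros)
  then have "((\<lambda>x. (r * cos (\<phi> x)) *\<^sub>R vector [1, 0] + (r * sin (\<phi> x)) *\<^sub>R vector [0, 1])
      has_derivative ?B) (at \<alpha>)"
    unfolding has_field_derivative_def
    by (intro has_derivative_add has_derivative_scaleR_left) (simp_all only: mult_commute_abs)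
  moreover have "?B = ?D"
    by (simp add: fun_eq_iff vec_eq_iff forall_2 sec_def J_def matrix_vector_mult_def sum_2
        minus_d_eq[OF assms] mult_ac)
  ultimately show "(sec r \<phi> has_derivative ?D) (at \<alpha>)"
    by (simp add: sec_basis[abs_def])
qed

lemma smooth_linear: "smooth (\<lambda>\<alpha>. c * \<alpha>)"
proof -
  have first: "deriv (\<lambda>\<alpha>. c * \<alpha>) = (\<lambda>_. c)"
    by (auto simp: fun_eq_iff intro!: DERIV_imp_deriv derivative_eq_intros)
  have const: "(deriv ^^ n) (\<lambda>_. b :: real) differentiable_on UNIV" for n and b :: real
  proof (induction n arbitrary: b)
    case (Suc n)
    have "deriv (\<lambda>_. b) = (\<lambda>_. 0)" by (simp add: fun_eq_iff)
    with Suc[of 0] show ?case by (simp add: funpow_Suc_right del: funpow.simps)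
  qed simp
  have "(deriv ^^ n) (\<lambda>\<alpha>. c * \<alpha>) differentiable_on UNIV" for n
  proof (cases n)
    case 0
    then show ?thesis by (auto intro!: derivative_intros)
  next
    case (Suc m)
    then show ?thesis using const[of m c] by (simp add: funpow_Suc_right first del: funpow.simps)
  qed
  then show ?thesis by (simp add: smooth_def)
qed

section \<open>The half-turn angle\<close>

lemma fibre_angle_half_multiple: "fibre_angle (\<lambda>\<alpha>. of_int k / 2 * \<alpha>)"
  unfolding fibre_angle_def
  by (auto intro!: continuous_intros exI[of _ k] simp: algebra_simps)

lemma zeros_half_angle:
  assumes "r \<noteq> 0"
  shows "zeros (sigma r (\<lambda>\<alpha>. \<alpha> / 2)) = {pi}"
proof (intro equalityI subsetI)
  fix x assume "x \<in> zeros (sigma r (\<lambda>\<alpha>. \<alpha> / 2))"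
  then have x: "0 \<le> x" "x < 2 * pi" "cos (x / 2) = cos (pi / 2)"
    using assms by (auto simp: zeros_def sigma_eq)
  then have "x / 2 = pi / 2"
    using cos_inj_pi[of "x / 2" "pi / 2"] by simp
  then show "x \<in> {pi}" by simp
qed (auto simp: zeros_def sigma_eq)

lemma transversal_zeros_half_angle:
  assumes "r > 0"
  shows "transversal_zeros (sigma r (\<lambda>\<alpha>. \<alpha> / 2))"
proof -
  have "sigma r (\<lambda>\<alpha>. \<alpha> / 2) (pi - t) * sigma r (\<lambda>\<alpha>. \<alpha> / 2) (pi + u) < 0"
    if "0 < t" "t < pi" "0 < u" "u < pi" for t u
  proof -
    have "cos ((pi - t) / 2) > 0"
      using that by (intro cos_gt_zero_pi) auto
    moreover have "cos ((pi + u) / 2) = - sin (u / 2)"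
      by (simp add: add_divide_distrib cos_add)
    moreover have "sin (u / 2) > 0"
      using that by (intro sin_gt_zero) auto
    ultimately show ?thesis
      using assms by (simp add: sigma_eq mult_less_0_iff zero_less_mult_iff)
  qed
  then have "changes_sign_at (sigma r (\<lambda>\<alpha>. \<alpha> / 2)) pi"
    unfolding changes_sign_at_def using pi_gt_zero by blast
  with assms show ?thesis
    by (simp add: transversal_zeros_def zeros_half_angle)
qed

lemma bit_of_int_surj:
  obtains k where "(of_int k :: bit) = c"
  by (cases c) (metis of_int_0 of_int_1)+

section \<open>The parity theorem\<close>

theorem proposition9p2:
  fixes g :: "real^2^2" and r :: real and \<phi> :: "real \<Rightarrow> real"
  assumes structure_group: "orthogonal_matrix g"
    and readout_on_E: "readout v* g = readout"
    and J_on_E: "g ** J = J ** g"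
    and r_pos: "r > 0"
    and angle: "fibre_angle \<phi>"
  defines "L \<equiv> line_of (sec r \<phi>)"
    and "Z \<equiv> zeros (sigma r \<phi>)"
  shows "line_subbundle g L
    \<and> (transversal_zeros (sigma r \<phi>) \<longrightarrow>
         finite Z
         \<and> (of_nat (card Z) :: bit) = w1 L
         \<and> (even (card Z) \<longleftrightarrow> w1 L = 0)
         \<and> (odd (card Z) \<longleftrightarrow> w1 L \<noteq> 0))
    \<and> (w1 L = 0 \<longleftrightarrow> orientable_line g L)
    \<and> (w1 L \<noteq> 0 \<longleftrightarrow> moebius_line g L)
    \<and> (\<forall>c::bit. \<exists>\<psi> \<theta>. fibre_angle \<psi> \<and> w1 (line_of (sec r \<psi>)) = c
          \<and> is_connection g \<theta> \<and> flat \<theta> \<and> parallel \<theta> (sec r \<psi>))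
    \<and> (smooth \<phi> \<longrightarrow> is_connection g (minus_d \<phi>) \<and> flat (minus_d \<phi>)
                    \<and> parallel (minus_d \<phi>) (sec r \<phi>))
    \<and> trivial_bundle g
    \<and> (w1 L \<noteq> 0 \<longrightarrow> Z \<noteq> {})
    \<and> (let \<psi> = (\<lambda>\<alpha>. \<alpha> / 2) in
         fibre_angle \<psi> \<and> transversal_zeros (sigma r \<psi>)
         \<and> w1 (line_of (sec r \<psi>)) \<noteq> 0
         \<and> zeros (sigma r \<psi>) = {pi})"
proof -
  have g: "g = mat 1"
    using clutching_matrix_is_identity[OF readout_on_E J_on_E] .
  have r: "r \<noteq> 0" using r_pos by simp
  obtain k where cont: "continuous_on UNIV \<phi>"
    and turn: "\<And>\<alpha>. \<phi> (\<alpha> + 2 * pi) = \<phi> \<alpha> + of_int k * pi"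
    using angle by (auto simp: fibre_angle_def)
  have w1: "w1 L = 0 \<longleftrightarrow> even k"
    unfolding L_def by (rule w1_line_of_sec[OF r cont turn])
  have sub: "line_subbundle g L"
    unfolding L_def g by (rule line_subbundle_line_of_sec[OF r cont turn])
  have parity: "finite Z" "even (card Z) \<longleftrightarrow> w1 L = 0" if "transversal_zeros (sigma r \<phi>)"
    using zeros_parity_of_sign_periodic[OF continuous_sigma[OF cont] sigma_turn[of \<phi>, OF turn] _ that]
    by (auto simp: Z_def w1 turn_sign_def split: if_splits)
  then have count: "(of_nat (card Z) :: bit) = w1 L" if "transversal_zeros (sigma r \<phi>)"
    using that bit_of_nat_eq_0_iff[of "card Z"] by (metis bit_not_zero_iff)
  have orient: "w1 L = 0 \<longleftrightarrow> orientable_line g L"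
    using line_clutching_iff[OF r cont turn, of 1]
    unfolding w1 unfolding orientable_line_def g L_def turn_sign_def by (simp split: if_splits)
  have moebius: "w1 L \<noteq> 0 \<longleftrightarrow> moebius_line g L"
    using line_clutching_iff[OF r cont turn, of "-1"]
    unfolding w1 unfolding moebius_line_def g L_def turn_sign_def by (simp split: if_splits)
  have connection: "is_connection g (minus_d \<psi>) \<and> flat (minus_d \<psi>) \<and> parallel (minus_d \<psi>) (sec r \<psi>)"
    if "smooth \<psi>" "fibre_angle \<psi>" for \<psi>
  proof -
    have "one_form (minus_d \<psi>)"
      using that one_form_minus_d by (auto simp: fibre_angle_def)
    then show ?thesis
      using one_form_flat parallel_minus_d[OF that(1)] J_on_E by (auto simp: is_connection_def)
  qed
  have half_w1: "w1 (line_of (sec r (\<lambda>\<alpha>. of_int m / 2 * \<alpha>))) = of_int m" for m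
  proof -
    have "line_degree (line_of (sec r (\<lambda>\<alpha>. of_int m / 2 * \<alpha>))) = m"
      by (rule line_degree_line_of_sec[OF r]) (auto intro!: continuous_intros simp: algebra_simps)
    then show ?thesis by (simp add: w1_def)
  qed
  have flat_exists: "\<exists>\<psi> \<theta>. fibre_angle \<psi> \<and> w1 (line_of (sec r \<psi>)) = c
      \<and> is_connection g \<theta> \<and> flat \<theta> \<and> parallel \<theta> (sec r \<psi>)" for c :: bit
  proof -
    obtain m where "(of_int m :: bit) = c" by (rule bit_of_int_surj)
    then show ?thesis
      using half_w1[of m] fibre_angle_half_multiple[of m] connection[OF smooth_linear fibre_angle_half_multiple]
      by blast
  qed
  have nonempty: "Z \<noteq> {}" if "w1 L \<noteq> 0"
    unfolding Z_def
    using that w1 sigma_turn[of \<phi>, OF turn]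
    by (intro zeros_nonempty_of_antiperiodic continuous_sigma[OF cont]) (simp add: turn_sign_def)
  have half: "fibre_angle (\<lambda>\<alpha>. \<alpha> / 2)" "w1 (line_of (sec r (\<lambda>\<alpha>. \<alpha> / 2))) \<noteq> 0"
    using fibre_angle_half_multiple[of 1] half_w1[of 1] by simp_all
  show ?thesis
    unfolding Let_def
    using sub parity count orient moebius flat_exists connection angle nonempty half
      trivial_bundle_identity[where 'n = 2] transversal_zeros_half_angle[OF r_pos] zeros_half_angle[OF r]
    by (simp add: g)
qed

end
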